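(* Let $N, A$ be fixed positive integers and $t, t_1, t_2$ fixed primes. (i) (Univariate closed form.) $A\,\sigma(t^{2e}) = 2Nt^{2e} + 1$ holds if and only if $$V\cdot\bigl(At - 2N(t-1)\bigr) = A + t - 1, \qquad V = t^{2e},$$ which is a linear equation in $V$: writing the coefficient $C = At - 2N(t-1)$, one has $V = (A+t-1)/C$. There is therefore no need to try the exponent $e$ one value at a time: if $C \nmid (A+t-1)$, the equation has no integer solution and all exponents of this prime are excluded at once. If $C$ divides $A+t-1$, then $V$ is uniquely determined, and one checks whether this $V$ is a power of $t^2$ (that is, of the form $t^{2e}$) to read off $e$. There is no iteration anywhere. (ii) (Bivariate Möbius enumeration.) For the equation $A\,\sigma(t_1^{2e_1})\,\sigma(t_2^{2e_2}) = 2NV_1V_2 + 1$, where $V_1 = t_1^{2e_1}$ and $V_2 = t_2^{2e_2}$, solving gives $$V_2(V_1) = \frac{At_1V_1 - A + D}{d_2V_1 - At_2}, \qquad D = (t_1-1)(t_2-1),\quad d_2 = At_1t_2 - 2ND.$$ This is a fractional-linear function of $V_1$ (a Möbius transformation), and it is monotone to the right of its unique pole. As $V_1 = t_1^{2e_1}$ ranges over all powers to the right of the pole, $V_2$ is confined to the closed envelope between two explicit rational endpoints (the value at the first power and the limiting value $At_1/d_2$), that is, an explicit interval, within which the powers of $t_2^2$ are finite in number (usually 0 to 2), each falling back to case (i). This process is finite and complete. (iii) (Higher-arity truncation: the fallback when three or more exponents are simultaneously unbounded; rare in practice.) Here the closed forms of (i) and (ii) do not apply directly, and one uses a "fix one,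 recurse on the rest" strategy.
   Context: $\sigma(m)$ denotes the sum of all positive divisors of $m$; for a prime $t$ and $V = t^{2e}$ one has $\sigma(t^{2e}) = (tV-1)/(t-1)$, which is linear in $V$. The exponents $e, e_1, e_2$ are unknown positive integers. The equations are instances of the quasiperfect equation $\sigma(n) = 2n+1$, where $n$ is the product of a fixed part $N$ with $\sigma(N) = A$ and unknown even powers of fixed primes not dividing $N$. The abundancy of $n$ is $\sigma(n)/n$; it increases strictly with each exponent of a prime factor of $n$. The strategy named in (iii) is the following. Pick any one unknown exponent $e$ and enumerate $e = 1, 2, 3, \dots$ value by value; each time $e$ is fixed there is one fewer unknown exponent, and the problem reduces to (ii), then to (i), all in finitely many steps. For a fixed $e$, let $N_{\mathrm{lo}}$ be the candidate $n$ in which all the other free exponents take their minimum value 1, and $A_{\mathrm{lo}} = \sigma(N_{\mathrm{lo}})$. If $A_{\mathrm{lo}} > 2N_{\mathrm{lo}} + 1$, then by monotonicity of the abundancy this $e$, all larger $e$, and every choice of the remaining exponents are excluded at once. The source concludes from this that there is a truncation value $e_0$ such that $e$ need only be enumerated up to $e_0$, so that the infinitely many cases are covered in finitely many steps. *)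

theory Defs
  imports "HOL-Analysis.Analysis" "HOL-Computational_Algebra.Primes"
begin

definition divisor_sum :: "nat \<Rightarrow> nat" where
  "divisor_sum m = (\<Sum>d | d dvd m. d)"


subsection \<open>One unknown exponent\<close>

definition sols1 :: "nat \<Rightarrow> nat \<Rightarrow> nat \<Rightarrow> nat set" where
  "sols1 N A t = {e. 1 \<le> e \<and> A * divisor_sum (t ^ (2 * e)) = 2 * N * t ^ (2 * e) + 1}"

text \<open>The coefficient may be zero or negative, so it is an integer.\<close>

definition lin_coeff :: "nat \<Rightarrow> nat \<Rightarrow> nat \<Rightarrow> int" where
  "lin_coeff N A t = int A * int t - 2 * int N * (int t - 1)"


subsection \<open>Two unknown exponents\<close>

definition sols2 :: "nat \<Rightarrow> nat \<Rightarrow> nat \<Rightarrow> nat \<Rightarrow> (nat \<times> nat) set" where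
  "sols2 N A t1 t2 = {(e1, e2). 1 \<le> e1 \<and> 1 \<le> e2 \<and>
     A * divisor_sum (t1 ^ (2 * e1)) * divisor_sum (t2 ^ (2 * e2))
       = 2 * N * t1 ^ (2 * e1) * t2 ^ (2 * e2) + 1}"

definition D_coeff :: "nat \<Rightarrow> nat \<Rightarrow> real" where
  "D_coeff t1 t2 = (real t1 - 1) * (real t2 - 1)"

definition d2_coeff :: "nat \<Rightarrow> nat \<Rightarrow> nat \<Rightarrow> nat \<Rightarrow> real" where
  "d2_coeff N A t1 t2 = real A * real t1 * real t2 - 2 * real N * D_coeff t1 t2"

definition V2_numer :: "nat \<Rightarrow> nat \<Rightarrow> nat \<Rightarrow> real \<Rightarrow> real" where
  "V2_numer A t1 t2 v = real A * real t1 * v - real A + D_coeff t1 t2"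

definition V2_denom :: "nat \<Rightarrow> nat \<Rightarrow> nat \<Rightarrow> nat \<Rightarrow> real \<Rightarrow> real" where
  "V2_denom N A t1 t2 v = d2_coeff N A t1 t2 * v - real A * real t2"

definition V2_fun :: "nat \<Rightarrow> nat \<Rightarrow> nat \<Rightarrow> nat \<Rightarrow> real \<Rightarrow> real" where
  "V2_fun N A t1 t2 v = V2_numer A t1 t2 v / V2_denom N A t1 t2 v"

text \<open>Determinant of the coefficient matrix of \<^const>\<open>V2_fun\<close>. The fraction is a (nonconstant)
  Moebius transformation exactly when this is nonzero. It can vanish, for instance for
  \<open>N = 3\<close>, \<open>A = 1\<close>, \<open>t1 = 2\<close>, \<open>t2 = 3\<close>, but only if \<^const>\<open>d2_coeff\<close> is negative.\<close>

definition V2_det :: "nat \<Rightarrow> nat \<Rightarrow> nat \<Rightarrow> nat \<Rightarrow> real" where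
  "V2_det N A t1 t2 = (real A * real t1) * (- (real A * real t2))
     - (D_coeff t1 t2 - real A) * d2_coeff N A t1 t2"

text \<open>The pole and the limiting value are only used when \<^const>\<open>d2_coeff\<close> is nonzero.\<close>

definition V2_pole :: "nat \<Rightarrow> nat \<Rightarrow> nat \<Rightarrow> nat \<Rightarrow> real" where
  "V2_pole N A t1 t2 = real A * real t2 / d2_coeff N A t1 t2"

definition V2_limit :: "nat \<Rightarrow> nat \<Rightarrow> nat \<Rightarrow> nat \<Rightarrow> real" where
  "V2_limit N A t1 t2 = real A * real t1 / d2_coeff N A t1 t2"

definition first_exp :: "nat \<Rightarrow> nat \<Rightarrow> nat \<Rightarrow> nat \<Rightarrow> nat" where
  "first_exp N A t1 t2 = (LEAST e. 1 \<le> e \<and> V2_pole N A t1 t2 < real (t1 ^ (2 * e)))"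

definition V2_first :: "nat \<Rightarrow> nat \<Rightarrow> nat \<Rightarrow> nat \<Rightarrow> real" where
  "V2_first N A t1 t2 = V2_fun N A t1 t2 (real (t1 ^ (2 * first_exp N A t1 t2)))"

text \<open>\<^const>\<open>closed_segment\<close> is the closed interval between two reals given in either order.\<close>

definition envelope :: "nat \<Rightarrow> nat \<Rightarrow> nat \<Rightarrow> nat \<Rightarrow> real set" where
  "envelope N A t1 t2 = closed_segment (V2_first N A t1 t2) (V2_limit N A t1 t2)"

definition candidates :: "nat \<Rightarrow> nat \<Rightarrow> nat \<Rightarrow> nat \<Rightarrow> nat set" where
  "candidates N A t1 t2 = {e. 1 \<le> e \<and> real (t2 ^ (2 * e)) \<in> envelope N A t1 t2}"


subsection \<open>Arbitrarily many unknown exponents\<close>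

text \<open>\<open>P\<close> is the set of primes with unknown exponents; the exponent of \<open>t \<in> P\<close> is \<open>2 * x t\<close>.\<close>

definition cand :: "nat \<Rightarrow> nat set \<Rightarrow> (nat \<Rightarrow> nat) \<Rightarrow> nat" where
  "cand N P x = N * (\<Prod>t\<in>P. t ^ (2 * x t))"

definition sols :: "nat \<Rightarrow> nat \<Rightarrow> nat set \<Rightarrow> (nat \<Rightarrow> nat) set" where
  "sols N A P = {x \<in> P \<rightarrow>\<^sub>E {1..}.
     A * (\<Prod>t\<in>P. divisor_sum (t ^ (2 * x t))) = 2 * cand N P x + 1}"

text \<open>Enumerating the exponent of \<open>t\<close> up to \<open>e0\<close> loses no solution: each fixed value \<open>e\<close> moves
  \<open>t ^ (2 * e)\<close> into the fixed part, and the solutions of the resulting problems in the remaining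
  exponents are all the solutions.\<close>

definition truncated_at :: "nat \<Rightarrow> nat \<Rightarrow> nat set \<Rightarrow> nat \<Rightarrow> nat \<Rightarrow> bool" where
  "truncated_at N A P t e0 \<longleftrightarrow>
     (\<forall>x \<in> sols N A P. x t \<le> e0) \<and>
     sols N A P = (\<Union>e\<in>{1..e0}. (\<lambda>x. x(t := e)) `
       sols (N * t ^ (2 * e)) (A * divisor_sum (t ^ (2 * e))) (P - {t}))"

text \<open>The recursion ``fix one exponent, recurse on the rest'' ends, after finitely many truncated
  enumerations, in problems with two unknown exponents, whichever exponent is fixed at each stage.
  Finiteness of the whole enumeration tree is expressed by the predicate being inductive.\<close>

inductive fix_one_recurse :: "nat \<Rightarrow> nat \<Rightarrow> nat set \<Rightarrow> bool" where
  two: "t1 \<noteq> t2 \<Longrightarrow> fix_one_recurse N A {t1, t2}"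
| fix_one: "finite P \<Longrightarrow> 3 \<le> card P \<Longrightarrow>
    \<forall>t\<in>P. \<exists>e0. truncated_at N A P t e0 \<and>
      (\<forall>e\<in>{1..e0}. fix_one_recurse (N * t ^ (2 * e)) (A * divisor_sum (t ^ (2 * e))) (P - {t}))
    \<Longrightarrow> fix_one_recurse N A P"

end

theory Submission
  imports Defs
begin

text \<open>For a prime \<open>t\<close> and \<open>V = t ^ k\<close> one has \<open>(t - 1) * \<sigma>(V) = t * V - 1\<close>. Multiplying a quasiperfect
  equation by the factors \<open>t - 1\<close> therefore turns it into an equation that is linear in each
  unknown prime power separately.

  With one unknown power the equation reads \<open>V * C = A + t - 1\<close>. The right-hand side is positive, so
  \<open>C\<close> cannot vanish for a solution and \<open>V\<close> is determined.

  With two unknown powers the equation reads \<open>V2 * denominator = numerator\<close>, both linear in \<open>V1\<close>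
  (\<open>two_exponents_iff_denom\<close>). The numerator is positive for \<open>V1 \<ge> 1\<close>, hence so is the denominator at
  every solution. This has two consequences: \<open>d2 > 0\<close>, and \<open>V1\<close> lies to the right of the pole. There
  the fractional linear function is monotone and converges, so that all its values at admissible
  powers lie between the first one and the limit (\<open>monotone_between_value_and_limit\<close>). A bounded
  interval contains finitely many powers of \<open>t2\<close>, and each of them leaves a problem with one unknown.

  For a set \<open>P\<close> of unknown exponents, the comparison with the lowest candidate does not by itself
  bound an exponent: if the abundancies of these candidates stay below 2, the test never
  excludes anything. A truncation value exists for a different reason, namely that the whole
  solution set is finite (\<open>finite_sols\<close>). Division of the equation by the prime powers gives
  \<open>A * (\<Prod>t\<in>P. \<sigma>(V t) / V t) = 2 * N + 1 / (\<Prod>t\<in>P. V t)\<close>. The left-hand side increases in every exponent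
  and tends to \<open>L = A * (\<Prod>t\<in>P. t / (t - 1))\<close>, without reaching it, while the right-hand side decreases
  to \<open>2 * N\<close>, without reaching it. If \<open>L \<le> 2 * N\<close>, the two sides never meet. If \<open>L > 2 * N\<close>, the left-hand
  side is larger as soon as all exponents are large, so that in every solution some exponent is below a
  common bound (\<open>some_exponent_bounded\<close>). Fixing that exponent leaves finitely many problems of the same
  kind with one unknown fewer, and induction on the number of unknowns applies. The largest value of
  an exponent among the finitely many solutions truncates its enumeration, and since this holds for
  every fixed part, the recursion down to two unknowns is a finite tree.

  If \<open>A = \<sigma>(N)\<close> and the primes of \<open>P\<close> do not divide \<open>N\<close>, multiplicativity of \<open>\<sigma>\<close> identifies the solutions
  with quasiperfect candidates. A lowest candidate that is too abundant then excludes all its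
  multiples, because abundancy does not decrease from a number to a multiple of it.\<close>


section \<open>The divisor sum\<close>

text \<open>The divisors are the powers \<open>t ^ i\<close> with \<open>i \<le> k\<close>, so this is the geometric sum. It is stated over the
  integers and without division, because \<open>lin_coeff\<close> may be negative.\<close>

lemma divisor_sum_prime_power:
  assumes "prime t"
  shows "(int t - 1) * int (divisor_sum (t ^ k)) = int t * int (t ^ k) - 1"
proof -
  have "{d. d dvd t ^ k} = (\<lambda>i. t ^ i) ` {..<Suc k}"
    using divides_primepow_nat[OF assms, of _ k] by (auto simp: less_Suc_eq_le)
  moreover have "inj_on (\<lambda>i. t ^ i) {..<Suc k}"
    using prime_gt_1_nat[OF assms] by (auto intro!: inj_onI)
  ultimately have "divisor_sum (t ^ k) = (\<Sum>i<Suc k. t ^ i)"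
    unfolding divisor_sum_def by (simp only: sum.reindex o_def)
  then have "int (divisor_sum (t ^ k)) = (\<Sum>i<Suc k. int t ^ i)"
    by (simp only: of_nat_sum of_nat_power)
  then show ?thesis
    using power_diff_1_eq[of "int t" "Suc k"] by simp
qed

lemma divisor_sum_prime_power_real:
  assumes "prime t"
  shows "(real t - 1) * real (divisor_sum (t ^ k)) = real t * real (t ^ k) - 1"
proof -
  have "of_int ((int t - 1) * int (divisor_sum (t ^ k))) = (of_int (int t * int (t ^ k) - 1) :: real)"
    by (simp only: divisor_sum_prime_power[OF assms])
  then show ?thesis by simp
qed

lemma divisor_sum_mult:
  assumes "coprime a b"
  shows "divisor_sum (a * b) = divisor_sum a * divisor_sum b"
proof -
  let ?A = "{d. d dvd a}" and ?B = "{d. d dvd b}"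
  have "inj_on (\<lambda>(x, y). x * y) (?A \<times> ?B)"
  proof (rule inj_onI, clarify)
    fix x y x' y' assume *: "x dvd a" "y dvd b" "x' dvd a" "y' dvd b" and eq: "x * y = x' * y'"
    have c: "coprime x y'" "coprime x' y" "coprime y x'" "coprime y' x"
      using assms * by (meson coprime_divisors coprime_commute)+
    have "x dvd x'" "x' dvd x" "y dvd y'" "y' dvd y"
      using eq c
      by (metis coprime_dvd_mult_left_iff dvd_triv_left, metis coprime_dvd_mult_left_iff dvd_triv_left,
          metis coprime_dvd_mult_right_iff dvd_triv_right, metis coprime_dvd_mult_right_iff dvd_triv_right)
    then show "x = x' \<and> y = y'" by (simp add: dvd_antisym)
  qed
  moreover have "{d. d dvd a * b} = (\<lambda>(x, y). x * y) ` (?A \<times> ?B)"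
  proof (intro equalityI subsetI)
    fix d assume "d \<in> {d. d dvd a * b}"
    then obtain x y where "d = x * y" "x dvd a" "y dvd b"
      using division_decomp[of d a b] by blast
    then show "d \<in> (\<lambda>(x, y). x * y) ` (?A \<times> ?B)"
      by (intro image_eqI[of _ _ "(x, y)"]) simp_all
  qed (auto intro: mult_dvd_mono)
  ultimately have "divisor_sum (a * b) = (\<Sum>(x, y)\<in>?A \<times> ?B. x * y)"
    unfolding divisor_sum_def by (simp add: sum.reindex case_prod_unfold)
  also have "\<dots> = divisor_sum a * divisor_sum b"
    unfolding divisor_sum_def sum_product sum.cartesian_product ..
  finally show ?thesis .
qed

lemma divisor_sum_cand:
  assumes "finite P" "\<forall>s\<in>P. prime s" "\<forall>s\<in>P. \<not> s dvd N"
  shows "divisor_sum (cand N P x) = divisor_sum N * (\<Prod>t\<in>P. divisor_sum (t ^ (2 * x t)))"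
  using assms
proof (induction P rule: finite_induct)
  case empty
  then show ?case by (simp add: cand_def)
next
  case (insert s P)
  have "coprime s t" if "t \<in> P" for t
    using that insert.hyps insert.prems by (intro primes_coprime) auto
  moreover have "coprime s N"
    using insert.prems by (intro prime_imp_coprime) auto
  ultimately have "coprime (s ^ (2 * x s)) (cand N P x)"
    unfolding cand_def by (auto intro!: prod_coprime_right)
  then have "divisor_sum (s ^ (2 * x s) * cand N P x)
      = divisor_sum (s ^ (2 * x s)) * divisor_sum (cand N P x)"
    by (rule divisor_sum_mult)
  moreover have "cand N (insert s P) x = s ^ (2 * x s) * cand N P x"
    using insert.hyps by (simp add: cand_def ac_simps)
  ultimately show ?case using insert by (simp add: ac_simps)
qed

text \<open>Multiplication by \<open>k\<close> sends divisors of \<open>m\<close> to divisors of \<open>k * m\<close>. After division by \<open>k * m\<close> this says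
  that the abundancy of a multiple of \<open>m\<close> is at least that of \<open>m\<close>.\<close>

lemma divisor_sum_multiple_ge:
  assumes "m > 0" "k > 0"
  shows "k * divisor_sum m \<le> divisor_sum (k * m)"
proof -
  have "k * divisor_sum m = (\<Sum>d\<in>(\<lambda>d. k * d) ` {d. d dvd m}. d)"
    unfolding divisor_sum_def using assms
    by (subst sum.reindex) (auto simp: inj_on_def sum_distrib_left)
  also have "\<dots> \<le> (\<Sum>d | d dvd k * m. d)"
    using assms by (intro sum_mono2) auto
  finally show ?thesis by (simp add: divisor_sum_def)
qed


section \<open>One unknown exponent\<close>

text \<open>The equation multiplied by \<open>t - 1\<close>, with the terms in \<open>V = t ^ k\<close> collected.\<close>

lemma one_exponent_iff_linear:
  assumes "prime t"
  shows "A * divisor_sum (t ^ k) = 2 * N * t ^ k + 1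
    \<longleftrightarrow> int (t ^ k) * lin_coeff N A t = int A + int t - 1"
proof -
  define V where "V = int (t ^ k)"
  define S where "S = int (divisor_sum (t ^ k))"
  have S: "(int t - 1) * S = int t * V - 1"
    unfolding S_def V_def by (rule divisor_sum_prime_power[OF assms])
  have t: "int t - 1 \<noteq> 0" using prime_gt_1_nat[OF assms] by simp
  have "A * divisor_sum (t ^ k) = 2 * N * t ^ k + 1
      \<longleftrightarrow> int (A * divisor_sum (t ^ k)) = int (2 * N * t ^ k + 1)"
    by (simp only: of_nat_eq_iff)
  also have "\<dots> \<longleftrightarrow> int A * S = 2 * int N * V + 1"
    by (simp add: S_def V_def add.commute)
  also have "\<dots> \<longleftrightarrow> (int t - 1) * (int A * S) = (int t - 1) * (2 * int N * V + 1)"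
    using t by simp
  also have "(int t - 1) * (int A * S) = int A * (int t * V - 1)"
    using S by (metis mult.left_commute)
  also have "int A * (int t * V - 1) = (int t - 1) * (2 * int N * V + 1)
      \<longleftrightarrow> V * lin_coeff N A t = int A + int t - 1"
    by (auto simp: lin_coeff_def algebra_simps)
  finally show ?thesis by (simp add: V_def)
qed

text \<open>The right-hand side \<open>A + t - 1\<close> of the linear equation is nonzero, so it determines \<open>t ^ (2 * e)\<close>.\<close>

lemma one_exponent_unique:
  assumes "A > 0" "prime t" "e \<in> sols1 N A t" "e' \<in> sols1 N A t"
  shows "e = e'"
proof -
  have "int (t ^ (2 * e)) * lin_coeff N A t = int A + int t - 1"
    "int (t ^ (2 * e')) * lin_coeff N A t = int A + int t - 1"
    using assms(3,4) one_exponent_iff_linear[OF assms(2)] unfolding sols1_def by blast+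
  moreover have "int A + int t - 1 > 0" using assms(1) prime_gt_1_nat[OF assms(2)] by simp
  ultimately have "t ^ (2 * e) = t ^ (2 * e')"
    by (metis mult_cancel_right mult_zero_right of_nat_eq_iff less_irrefl)
  then show ?thesis using prime_gt_1_nat[OF assms(2)] by simp
qed

lemma finite_sols1:
  assumes "A > 0" "prime t"
  shows "finite (sols1 N A t)"
proof (cases "sols1 N A t = {}")
  case False
  then obtain e where "e \<in> sols1 N A t" by blast
  then have "sols1 N A t \<subseteq> {e}" using one_exponent_unique[OF assms] by blast
  then show ?thesis by (rule finite_subset) simp
qed simp

lemma one_exponent_closed_form:
  fixes N A t :: nat
  assumes "A > 0" "prime t"
  defines "C \<equiv> lin_coeff N A t" and "R \<equiv> int A + int t - 1"
  shows "int (t ^ (2 * e)) * C = R \<longleftrightarrow> C \<noteq> 0 \<and> real (t ^ (2 * e)) = of_int R / of_int C"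
    and "\<not> C dvd R \<Longrightarrow> (\<nexists>V::int. V * C = R) \<and> sols1 N A t = {}"
    and "C dvd R \<Longrightarrow> (\<exists>!V::int. V * C = R) \<and> (R div C) * C = R \<and>
          sols1 N A t = {e. 1 \<le> e \<and> int (t ^ (2 * e)) = R div C}"
proof -
  have R: "R > 0" using assms prime_gt_1_nat[of t] by simp
  have sol: "e \<in> sols1 N A t \<longleftrightarrow> 1 \<le> e \<and> int (t ^ (2 * e)) * C = R" for e
    using one_exponent_iff_linear[OF assms(2), of A "2 * e" N] by (auto simp: sols1_def C_def R_def)
  have "int (t ^ (2 * e)) * C = R \<longleftrightarrow> of_int (int (t ^ (2 * e)) * C) = (of_int R :: real)"
    by (simp only: of_int_eq_iff)
  also have "\<dots> \<longleftrightarrow> real (t ^ (2 * e)) * of_int C = of_int R"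
    by (simp only: of_int_mult of_int_of_nat_eq)
  also have "\<dots> \<longleftrightarrow> C \<noteq> 0 \<and> real (t ^ (2 * e)) = of_int R / of_int C"
    using R by (auto simp: eq_divide_eq)
  finally show "int (t ^ (2 * e)) * C = R \<longleftrightarrow> C \<noteq> 0 \<and> real (t ^ (2 * e)) = of_int R / of_int C" .
  show "(\<nexists>V::int. V * C = R) \<and> sols1 N A t = {}" if "\<not> C dvd R"
    using that sol by auto
  show "(\<exists>!V::int. V * C = R) \<and> (R div C) * C = R \<and>
      sols1 N A t = {e. 1 \<le> e \<and> int (t ^ (2 * e)) = R div C}" if "C dvd R"
  proof -
    have C: "C \<noteq> 0" using that R by auto
    have eq: "V * C = R \<longleftrightarrow> V = R div C" for V using that C by auto
    show ?thesis unfolding sol set_eq_iff mem_Collect_eq eq by simp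
  qed
qed


section \<open>Fractional linear functions right of the pole\<close>

text \<open>The condition \<open>c \<noteq> 0\<close> puts the pole at the finite point \<open>- d / c\<close>; the behaviour to the right of it
  is governed by the determinant \<open>a * d - b * c\<close>.\<close>

context
  fixes a b c d :: real and f :: "real \<Rightarrow> real"
  assumes f: "f = (\<lambda>v. (a * v + b) / (c * v + d))" and c: "c \<noteq> 0"
begin

lemma moebius_denom: "c * v + d = c * (v - (- d / c))"
  using c by (simp add: field_simps)

text \<open>The difference of two values carries the sign of the determinant, since the denominator
  \<open>c * (v - pole)\<close> has constant sign to the right of the pole. All monotonicity statements follow
  from this.\<close>

lemma moebius_diff:
  assumes "- d / c < v" "- d / c < w"
  shows "f w - f v = (a * d - b * c) * (w - v) / ((c * v + d) * (c * w + d))"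
    and "(c * v + d) * (c * w + d) > 0"
proof -
  have nz: "c * v + d \<noteq> 0" "c * w + d \<noteq> 0"
    using assms c by (auto simp: moebius_denom)
  show "f w - f v = (a * d - b * c) * (w - v) / ((c * v + d) * (c * w + d))"
    unfolding f using nz by (simp add: divide_simps) (simp add: algebra_simps)
  have "(c * v + d) * (c * w + d) = (c * c) * ((v - (- d / c)) * (w - (- d / c)))"
    by (subst (1 2) moebius_denom) (simp only: ac_simps)
  also have "\<dots> > 0"
  proof (intro mult_pos_pos[of "c * c"])
    show "0 < c * c" using c not_real_square_gt_zero by blast
  qed (use assms in auto)
  finally show "(c * v + d) * (c * w + d) > 0" .
qed

lemma moebius_strict_mono:
  assumes "a * d - b * c > 0"
  shows "strict_mono_on {- d / c<..} f"
proof (rule strict_mono_onI)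
  fix v w assume "v \<in> {- d / c<..}" "w \<in> {- d / c<..}" "v < w"
  then have "f w - f v > 0"
    using moebius_diff[of v w] assms by simp
  then show "f v < f w" by simp
qed

lemma moebius_strict_antimono:
  assumes "a * d - b * c < 0"
  shows "strict_antimono_on {- d / c<..} f"
proof (rule monotone_onI)
  fix v w assume "v \<in> {- d / c<..}" "w \<in> {- d / c<..}" "v < w"
  then have "f w - f v < 0"
    using moebius_diff[of v w] assms by (simp add: divide_neg_pos mult_neg_pos)
  then show "f v > f w" by simp
qed

lemma moebius_monotone: "mono_on {- d / c<..} f \<or> antimono_on {- d / c<..} f"
proof (cases "a * d - b * c" "0 :: real" rule: linorder_cases)
  case less
  then show ?thesis
    using moebius_strict_antimono by (auto simp: monotone_on_def order_le_less)
next
  case equal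
  then have "f v = f w" if "- d / c < v" "- d / c < w" for v w
    using moebius_diff(1)[OF that] by simp
  then have "mono_on {- d / c<..} f" by (intro mono_onI) (metis greaterThan_iff order_refl)
  then show ?thesis ..
next
  case greater
  then show ?thesis using moebius_strict_mono strict_mono_on_imp_mono_on by blast
qed

lemma moebius_tendsto: "(f \<longlongrightarrow> a / c) at_top"
proof -
  have "((\<lambda>v. (a + b * inverse v) / (c + d * inverse v)) \<longlongrightarrow> (a + b * 0) / (c + d * 0)) at_top"
    using c by (intro tendsto_intros tendsto_inverse_0_at_top filterlim_ident) auto
  moreover have "\<forall>\<^sub>F v in at_top. (a + b * inverse v) / (c + d * inverse v) = f v"
    using eventually_gt_at_top[of "0::real"]
  proof eventually_elim
    case (elim v)
    have "a * v + b = v * (a + b * inverse v)" "c * v + d = v * (c + d * inverse v)"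
      using elim by (simp_all add: distrib_left)
    then show ?case using elim by (simp add: f)
  qed
  ultimately show ?thesis by (simp add: Lim_transform_eventually)
qed

text \<open>A nonzero determinant means that numerator and denominator have no common zero. At the pole the
  absolute value of the quotient therefore tends to infinity, and elsewhere it is continuous.\<close>

lemma moebius_pole_iff:
  assumes "a * d - b * c \<noteq> 0"
  shows "filterlim f at_infinity (at v) \<longleftrightarrow> v = - d / c"
proof
  assume lim: "filterlim f at_infinity (at v)"
  show "v = - d / c"
  proof (rule ccontr)
    assume "v \<noteq> - d / c"
    then have "c * v + d \<noteq> 0" using c by (simp add: moebius_denom)
    then have "(f \<longlongrightarrow> (a * v + b) / (c * v + d)) (at v)"
      unfolding f by (intro tendsto_intros)
    then show False using lim not_tendsto_and_filterlim_at_infinity[OF at_neq_bot] by blast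
  qed
next
  assume v: "v = - d / c"
  have "a * v + b \<noteq> 0" using assms c by (auto simp: v field_simps)
  moreover have "c * v + d = 0" using c by (simp add: v)
  then have "((\<lambda>x. c * x + d) \<longlongrightarrow> 0) (at v)"
    by (auto intro!: tendsto_eq_intros)
  moreover have "\<forall>\<^sub>F x in at v. c * x + d \<noteq> 0"
    using c by (auto simp: eventually_at_filter moebius_denom v)
  ultimately show "filterlim f at_infinity (at v)"
    unfolding f
    by (intro filterlim_divide_at_infinity[of _ "a * v + b"]) 
       (auto intro!: tendsto_intros simp: filterlim_at)
qed

end

text \<open>This is what makes the envelope of the values explicit: no knowledge of the direction of
  monotonicity is needed, because \<^const>\<open>closed_segment\<close> accepts its end points in either order.\<close>

lemma monotone_between_value_and_limit:
  fixes f :: "real \<Rightarrow> real"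
  assumes "mono_on {p<..} f \<or> antimono_on {p<..} f" "(f \<longlongrightarrow> L) at_top" "p < v0" "v0 \<le> v"
  shows "f v \<in> closed_segment (f v0) L"
  using assms(1)
proof
  assume m: "mono_on {p<..} f"
  have "f v0 \<le> f v" using m assms by (auto intro: mono_onD)
  moreover have "f v \<le> L"
    using assms(3,4) m
    by (intro tendsto_lowerbound[OF assms(2)] eventually_mono[OF eventually_ge_at_top[of v]])
       (auto intro: mono_onD)
  ultimately show ?thesis by (auto simp: closed_segment_eq_real_ivl)
next
  assume m: "antimono_on {p<..} f"
  have "f v0 \<ge> f v" using m assms by (auto simp: monotone_on_def)
  moreover have "f v \<ge> L"
    using assms(3,4) m
    by (intro tendsto_upperbound[OF assms(2)] eventually_mono[OF eventually_ge_at_top[of v]])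
       (auto simp: monotone_on_def)
  ultimately show ?thesis by (auto simp: closed_segment_eq_real_ivl)
qed



section \<open>Two unknown exponents\<close>

text \<open>The equation multiplied by \<open>D = (t1 - 1) * (t2 - 1)\<close> and sorted by \<open>V2 = t2 ^ k2\<close>. Without the
  division it also holds where the denominator vanishes.\<close>

lemma two_exponents_iff_denom:
  assumes "prime t1" "prime t2"
  shows "A * divisor_sum (t1 ^ k1) * divisor_sum (t2 ^ k2) = 2 * N * t1 ^ k1 * t2 ^ k2 + 1
    \<longleftrightarrow> real (t2 ^ k2) * V2_denom N A t1 t2 (real (t1 ^ k1)) = V2_numer A t1 t2 (real (t1 ^ k1))"
proof -
  define V1 V2 where "V1 = real (t1 ^ k1)" and "V2 = real (t2 ^ k2)"
  define S1 S2 where "S1 = real (divisor_sum (t1 ^ k1))" and "S2 = real (divisor_sum (t2 ^ k2))"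
  define D where "D = D_coeff t1 t2"
  have S: "(real t1 - 1) * S1 = real t1 * V1 - 1" "(real t2 - 1) * S2 = real t2 * V2 - 1"
    unfolding S1_def S2_def V1_def V2_def
    by (rule divisor_sum_prime_power_real assms)+
  have D: "D \<noteq> 0"
    using prime_gt_1_nat[OF assms(1)] prime_gt_1_nat[OF assms(2)] by (simp add: D_def D_coeff_def)
  have "A * divisor_sum (t1 ^ k1) * divisor_sum (t2 ^ k2) = 2 * N * t1 ^ k1 * t2 ^ k2 + 1
      \<longleftrightarrow> real (A * divisor_sum (t1 ^ k1) * divisor_sum (t2 ^ k2)) = real (2 * N * t1 ^ k1 * t2 ^ k2 + 1)"
    by (simp only: of_nat_eq_iff)
  also have "\<dots> \<longleftrightarrow> real A * S1 * S2 = 2 * real N * V1 * V2 + 1"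
    by (simp add: S1_def S2_def V1_def V2_def add.commute)
  also have "\<dots> \<longleftrightarrow> D * (real A * S1 * S2) = D * (2 * real N * V1 * V2 + 1)"
    using D by simp
  also have "D * (real A * S1 * S2) = real A * ((real t1 - 1) * S1) * ((real t2 - 1) * S2)"
    by (simp add: D_def D_coeff_def)
  also have "\<dots> = real A * (real t1 * V1 - 1) * (real t2 * V2 - 1)"
    by (simp only: S)
  also have "\<dots> = D * (2 * real N * V1 * V2 + 1)
      \<longleftrightarrow> V2 * V2_denom N A t1 t2 V1 = V2_numer A t1 t2 V1"
    unfolding V2_denom_def V2_numer_def d2_coeff_def D_def[symmetric]
    by (auto simp: algebra_simps)
  finally show ?thesis by (simp add: V1_def V2_def)
qed

lemma D_coeff_pos: "prime t1 \<Longrightarrow> prime t2 \<Longrightarrow> D_coeff t1 t2 > 0"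
  using prime_gt_1_nat[of t1] prime_gt_1_nat[of t2] by (simp add: D_coeff_def)

lemma V2_numer_pos:
  assumes "prime t1" "prime t2" "v \<ge> 1"
  shows "V2_numer A t1 t2 v > 0"
proof -
  have "real t1 * v \<ge> 1 * 1"
    using prime_gt_1_nat[OF assms(1)] assms(3) by (intro mult_mono) auto
  then have "real A * (real t1 * v - 1) \<ge> 0" by simp
  then show ?thesis
    using D_coeff_pos[OF assms(1,2)] by (simp add: V2_numer_def algebra_simps)
qed

text \<open>The product of the denominator with \<open>V2 > 0\<close> is the positive numerator. This positivity is the
  reason why no solution lies at the pole or to the left of it, and why \<open>d2\<close> must be positive.\<close>

lemma V2_denom_pos:
  assumes "prime t1" "prime t2"
    and "A * divisor_sum (t1 ^ k1) * divisor_sum (t2 ^ k2) = 2 * N * t1 ^ k1 * t2 ^ k2 + 1"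
  shows "V2_denom N A t1 t2 (real (t1 ^ k1)) > 0"
proof -
  have "t2 ^ k2 > 0" using assms(2) by (simp add: prime_gt_0_nat)
  have "V2_numer A t1 t2 (real (t1 ^ k1)) > 0"
    using prime_ge_1_nat[OF assms(1)] by (intro V2_numer_pos assms) (simp add: one_le_power)
  then have "real (t2 ^ k2) * V2_denom N A t1 t2 (real (t1 ^ k1)) > 0"
    using assms two_exponents_iff_denom by simp
  then show ?thesis using \<open>t2 ^ k2 > 0\<close> by (simp add: zero_less_mult_iff)
qed

lemma two_exponents_iff_V2_fun:
  assumes "prime t1" "prime t2"
  shows "A * divisor_sum (t1 ^ k1) * divisor_sum (t2 ^ k2) = 2 * N * t1 ^ k1 * t2 ^ k2 + 1
    \<longleftrightarrow> V2_denom N A t1 t2 (real (t1 ^ k1)) \<noteq> 0 \<and>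
        real (t2 ^ k2) = V2_fun N A t1 t2 (real (t1 ^ k1))"
  using two_exponents_iff_denom[OF assms, of A k1 k2 N] V2_denom_pos[OF assms, of A k1 k2 N]
  by (auto simp: V2_fun_def eq_divide_eq)

lemma d2_coeff_pos:
  assumes "prime t1" "prime t2"
    and "A * divisor_sum (t1 ^ k1) * divisor_sum (t2 ^ k2) = 2 * N * t1 ^ k1 * t2 ^ k2 + 1"
  shows "d2_coeff N A t1 t2 > 0"
proof -
  have "d2_coeff N A t1 t2 * real (t1 ^ k1) > real A * real t2"
    using V2_denom_pos[OF assms] by (simp add: V2_denom_def)
  then have "d2_coeff N A t1 t2 * real (t1 ^ k1) > 0"
    by (rule le_less_trans[rotated]) simp
  then show ?thesis by (simp add: zero_less_mult_iff)
qed

lemma d2_coeff_pos_if_solvable: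
  assumes "prime t1" "prime t2" "sols2 N A t1 t2 \<noteq> {}"
  shows "d2_coeff N A t1 t2 > 0"
  using assms(3) d2_coeff_pos[OF assms(1,2)] by (auto simp: sols2_def)

text \<open>The term \<open>A\<^sup>2 * t1 * t2\<close> cancels, which leaves a product whose sign can be read off if \<open>d2 > 0\<close>.\<close>

lemma V2_det_eq: "V2_det N A t1 t2 = - D_coeff t1 t2 * (d2_coeff N A t1 t2 + 2 * real A * real N)"
  by (simp add: V2_det_def d2_coeff_def algebra_simps)

lemma V2_det_nonzero:
  assumes "prime t1" "prime t2" "d2_coeff N A t1 t2 > 0"
  shows "V2_det N A t1 t2 \<noteq> 0"
proof -
  have "d2_coeff N A t1 t2 + 2 * real A * real N > 0"
    using assms(3) by (intro add_pos_nonneg) auto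
  then show ?thesis using D_coeff_pos[OF assms(1,2)] by (simp add: V2_det_eq)
qed

text \<open>The next two equations write the function and its pole in the form \<open>(a * v + b) / (c * v + d)\<close> and
  \<open>- d / c\<close> to which the general facts apply.\<close>

lemma V2_fun_alt: "V2_fun N A t1 t2 = (\<lambda>v. (real A * real t1 * v + (D_coeff t1 t2 - real A)) /
    (d2_coeff N A t1 t2 * v + - (real A * real t2)))"
  by (simp add: fun_eq_iff V2_fun_def V2_numer_def V2_denom_def algebra_simps)

lemma V2_pole_alt: "V2_pole N A t1 t2 = - (- (real A * real t2)) / d2_coeff N A t1 t2"
  by (simp add: V2_pole_def)

lemma V2_pole_iff:
  assumes "d2_coeff N A t1 t2 \<noteq> 0"
  shows "V2_denom N A t1 t2 v = 0 \<longleftrightarrow> v = V2_pole N A t1 t2"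
  using assms by (auto simp: V2_denom_def V2_pole_def field_simps)

lemma V2_fun_monotone:
  assumes "d2_coeff N A t1 t2 \<noteq> 0"
  shows "mono_on {V2_pole N A t1 t2<..} (V2_fun N A t1 t2)
    \<or> antimono_on {V2_pole N A t1 t2<..} (V2_fun N A t1 t2)"
  unfolding V2_pole_alt by (rule moebius_monotone[OF V2_fun_alt assms])

lemma V2_fun_strictly_monotone:
  assumes "d2_coeff N A t1 t2 \<noteq> 0" "V2_det N A t1 t2 \<noteq> 0"
  shows "strict_mono_on {V2_pole N A t1 t2<..} (V2_fun N A t1 t2)
    \<or> strict_antimono_on {V2_pole N A t1 t2<..} (V2_fun N A t1 t2)"
  using assms(2) moebius_strict_mono[OF V2_fun_alt assms(1)]
    moebius_strict_antimono[OF V2_fun_alt assms(1)]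
  unfolding V2_pole_alt V2_det_def by linarith

lemma V2_fun_pole:
  assumes "d2_coeff N A t1 t2 \<noteq> 0" "V2_det N A t1 t2 \<noteq> 0"
  shows "filterlim (V2_fun N A t1 t2) at_infinity (at v) \<longleftrightarrow> v = V2_pole N A t1 t2"
  using moebius_pole_iff[OF V2_fun_alt assms(1)] assms(2)
  unfolding V2_pole_alt V2_det_def by simp

lemma V2_fun_tendsto:
  assumes "d2_coeff N A t1 t2 \<noteq> 0"
  shows "(V2_fun N A t1 t2 \<longlongrightarrow> V2_limit N A t1 t2) at_top"
  unfolding V2_limit_def by (rule moebius_tendsto[OF V2_fun_alt assms])

lemma V2_rational: "V2_first N A t1 t2 \<in> \<rat>" "V2_limit N A t1 t2 \<in> \<rat>"
  by (auto simp: V2_first_def V2_limit_def V2_fun_def V2_numer_def V2_denom_def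
      d2_coeff_def D_coeff_def)

lemma finite_even_powers_below:
  assumes "(2::nat) \<le> q"
  shows "finite {e. real (q ^ (2 * e)) \<le> B}"
proof -
  have "e \<le> nat \<lceil>B\<rceil>" if "real (q ^ (2 * e)) \<le> B" for e
  proof -
    have "e < 2 ^ e" by (rule less_exp)
    also have "\<dots> \<le> q ^ e" using assms by (rule power_mono) simp
    also have "\<dots> \<le> q ^ (2 * e)" using assms by (intro power_increasing) auto
    finally have "real e < real (q ^ (2 * e))" by (simp only: of_nat_less_iff)
    then show ?thesis using that by linarith
  qed
  then show ?thesis by (auto intro: finite_subset[of _ "{..nat \<lceil>B\<rceil>}"])
qed

text \<open>The powers of \<open>t1\<close> are unbounded, so the least exponent beyond the pole exists.\<close>

lemma first_exp:
  assumes "prime t1"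
  shows "1 \<le> first_exp N A t1 t2" "V2_pole N A t1 t2 < real (t1 ^ (2 * first_exp N A t1 t2))"
proof -
  have t1: "2 \<le> t1" using assms by (rule prime_ge_2_nat)
  have "finite ({0} \<union> {e. real (t1 ^ (2 * e)) \<le> V2_pole N A t1 t2})"
    by (intro finite_UnI finite_even_powers_below t1) simp
  then obtain e where "e \<notin> {0} \<union> {e. real (t1 ^ (2 * e)) \<le> V2_pole N A t1 t2}"
    using ex_new_if_finite[OF infinite_UNIV_nat] by metis
  then have "1 \<le> e \<and> V2_pole N A t1 t2 < real (t1 ^ (2 * e))" by auto
  then have "1 \<le> first_exp N A t1 t2 \<and> V2_pole N A t1 t2 < real (t1 ^ (2 * first_exp N A t1 t2))"
    unfolding first_exp_def by (rule LeastI)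
  then show "1 \<le> first_exp N A t1 t2" "V2_pole N A t1 t2 < real (t1 ^ (2 * first_exp N A t1 t2))"
    by simp_all
qed

lemma V2_fun_in_envelope:
  assumes "prime t1" "d2_coeff N A t1 t2 \<noteq> 0" "1 \<le> e" "V2_pole N A t1 t2 < real (t1 ^ (2 * e))"
  shows "V2_fun N A t1 t2 (real (t1 ^ (2 * e))) \<in> envelope N A t1 t2"
  unfolding envelope_def V2_first_def
proof (rule monotone_between_value_and_limit[OF V2_fun_monotone[OF assms(2)] V2_fun_tendsto[OF assms(2)]])
  show "V2_pole N A t1 t2 < real (t1 ^ (2 * first_exp N A t1 t2))"
    by (rule first_exp[OF assms(1)])
  have "first_exp N A t1 t2 \<le> e"
    unfolding first_exp_def using assms(3,4) by (intro Least_le conjI)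
  then have "t1 ^ (2 * first_exp N A t1 t2) \<le> t1 ^ (2 * e)"
    using prime_gt_0_nat[OF assms(1)] by (intro power_increasing) auto
  then show "real (t1 ^ (2 * first_exp N A t1 t2)) \<le> real (t1 ^ (2 * e))"
    by (simp only: of_nat_le_iff)
qed

lemma finite_candidates:
  assumes "prime t2"
  shows "finite (candidates N A t1 t2)"
proof (rule finite_subset)
  show "candidates N A t1 t2
      \<subseteq> {e. real (t2 ^ (2 * e)) \<le> max (V2_first N A t1 t2) (V2_limit N A t1 t2)}"
    by (auto simp: candidates_def envelope_def closed_segment_eq_real_ivl split: if_splits)
qed (rule finite_even_powers_below[OF prime_ge_2_nat[OF assms]])

lemma sols2_right_of_pole:
  assumes "prime t1" "prime t2"
  shows "\<forall>(e1, e2) \<in> sols2 N A t1 t2. V2_pole N A t1 t2 < real (t1 ^ (2 * e1))"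
proof clarify
  fix e1 e2 assume "(e1, e2) \<in> sols2 N A t1 t2"
  then have eq: "A * divisor_sum (t1 ^ (2 * e1)) * divisor_sum (t2 ^ (2 * e2))
      = 2 * N * t1 ^ (2 * e1) * t2 ^ (2 * e2) + 1"
    by (simp add: sols2_def)
  show "V2_pole N A t1 t2 < real (t1 ^ (2 * e1))"
    using V2_denom_pos[OF assms eq] d2_coeff_pos[OF assms eq]
    by (simp add: V2_denom_def V2_pole_def field_simps)
qed

text \<open>A solution has its \<open>V1\<close> to the right of the pole, so its \<open>V2\<close>, being the value of the function there,
  lies in the envelope; once \<open>e2\<close> is fixed, its divisor sum and its power belong to the fixed part.\<close>

lemma sols2_eq_union_sols1:
  assumes "prime t1" "prime t2"
  shows "sols2 N A t1 t2 = (\<Union>e2 \<in> candidates N A t1 t2.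
    sols1 (N * t2 ^ (2 * e2)) (A * divisor_sum (t2 ^ (2 * e2))) t1 \<times> {e2})"
proof (intro equalityI subrelI)
  fix e1 e2 assume sol: "(e1, e2) \<in> sols2 N A t1 t2"
  then have e: "1 \<le> e1" "1 \<le> e2" and
    eq: "A * divisor_sum (t1 ^ (2 * e1)) * divisor_sum (t2 ^ (2 * e2))
      = 2 * N * t1 ^ (2 * e1) * t2 ^ (2 * e2) + 1"
    by (simp_all add: sols2_def)
  have "d2_coeff N A t1 t2 \<noteq> 0" using d2_coeff_pos[OF assms eq] by simp
  then have "V2_fun N A t1 t2 (real (t1 ^ (2 * e1))) \<in> envelope N A t1 t2"
    using V2_fun_in_envelope[OF assms(1)] sols2_right_of_pole[OF assms] sol e by blast
  then have "e2 \<in> candidates N A t1 t2"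
    using e two_exponents_iff_V2_fun[OF assms, THEN iffD1, OF eq] by (simp add: candidates_def)
  moreover have "e1 \<in> sols1 (N * t2 ^ (2 * e2)) (A * divisor_sum (t2 ^ (2 * e2))) t1"
    using e eq by (simp add: sols1_def ac_simps)
  ultimately show "(e1, e2) \<in> (\<Union>e2 \<in> candidates N A t1 t2.
      sols1 (N * t2 ^ (2 * e2)) (A * divisor_sum (t2 ^ (2 * e2))) t1 \<times> {e2})"
    by blast
next
  fix e1 e2
  assume "(e1, e2) \<in> (\<Union>e2 \<in> candidates N A t1 t2.
      sols1 (N * t2 ^ (2 * e2)) (A * divisor_sum (t2 ^ (2 * e2))) t1 \<times> {e2})"
  then show "(e1, e2) \<in> sols2 N A t1 t2"
    by (auto simp: sols2_def sols1_def candidates_def ac_simps)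
qed

lemma divisor_sum_pos: "m > 0 \<Longrightarrow> divisor_sum m > 0"
  unfolding divisor_sum_def by (rule sum_pos2[of _ 1]) auto

lemma finite_sols2:
  assumes "A > 0" "prime t1" "prime t2"
  shows "finite (sols2 N A t1 t2)"
proof -
  have "A * divisor_sum (t2 ^ (2 * e)) > 0" for e
    using assms prime_gt_0_nat by (simp add: divisor_sum_pos)
  then show ?thesis
    unfolding sols2_eq_union_sols1[OF assms(2,3)]
    using finite_candidates[OF assms(3)] finite_sols1 assms(2) by blast
qed


section \<open>Arbitrarily many unknown exponents\<close>

definition power_abundancy :: "nat \<Rightarrow> nat \<Rightarrow> real" where
  "power_abundancy t e = real (divisor_sum (t ^ (2 * e))) / real (t ^ (2 * e))"

text \<open>All dependence on \<open>e\<close> is in the geometric sequence \<open>1 / V\<close> with ratio \<open>1 / t\<^sup>2\<close>. Monotonicity, the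
  strict upper bound \<open>t / (t - 1)\<close> and the limit are read off from this form.\<close>

lemma power_abundancy_eq:
  assumes "prime t"
  shows "power_abundancy t e = real t / (real t - 1) - 1 / (real t - 1) * (1 / (real t)\<^sup>2) ^ e"
proof -
  have t: "real t - 1 > 0" "real t > 0" using prime_gt_1_nat[OF assms] by simp_all
  have "real (divisor_sum (t ^ (2 * e))) = (real t * real (t ^ (2 * e)) - 1) / (real t - 1)"
    using divisor_sum_prime_power_real[OF assms, of "2 * e"] t by (simp add: field_simps)
  then show ?thesis
    using t by (simp add: power_abundancy_def power_one_over power_mult divide_simps)
qed

lemma power_abundancy_less:
  assumes "prime t"
  shows "power_abundancy t e < real t / (real t - 1)"
  using prime_gt_1_nat[OF assms] by (simp add: power_abundancy_eq[OF assms])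

lemma power_abundancy_nonneg: "0 \<le> power_abundancy t e"
  by (simp add: power_abundancy_def)

lemma power_abundancy_mono:
  assumes "prime t" "e \<le> e'"
  shows "power_abundancy t e \<le> power_abundancy t e'"
proof -
  have t: "real t > 1" using prime_gt_1_nat[OF assms(1)] by simp
  have "(1 / (real t)\<^sup>2) ^ e' \<le> (1 / (real t)\<^sup>2) ^ e"
    using t assms(2) by (intro power_decreasing) (auto simp: one_le_power)
  then show ?thesis
    using t unfolding power_abundancy_eq[OF assms(1)]
    by (intro diff_left_mono mult_left_mono) auto
qed

lemma inverse_even_power_tendsto_0:
  assumes "prime t"
  shows "(\<lambda>e. 1 / real (t ^ (2 * e))) \<longlonglongrightarrow> 0"
proof -
  have "real t > 1" using prime_gt_1_nat[OF assms] by simp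
  then have "(\<lambda>e. (1 / (real t)\<^sup>2) ^ e) \<longlonglongrightarrow> 0"
    by (intro LIMSEQ_power_zero) (auto simp: one_less_power)
  then show ?thesis by (simp add: power_one_over power_mult)
qed

lemma power_abundancy_tendsto:
  assumes "prime t"
  shows "power_abundancy t \<longlonglongrightarrow> real t / (real t - 1)"
proof -
  have "(\<lambda>e. real t / (real t - 1) - 1 / (real t - 1) * (1 / real (t ^ (2 * e))))
      \<longlonglongrightarrow> real t / (real t - 1) - 1 / (real t - 1) * 0"
    by (intro tendsto_intros inverse_even_power_tendsto_0 assms)
  moreover have "power_abundancy t
      = (\<lambda>e. real t / (real t - 1) - 1 / (real t - 1) * (1 / real (t ^ (2 * e))))"
    by (simp add: fun_eq_iff power_abundancy_eq[OF assms] power_one_over power_mult)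
  ultimately show ?thesis by simp
qed

text \<open>The equation divided by the product of the unknown powers. Now one side increases with the
  exponents and the other side decreases.\<close>

lemma equation_iff_abundancy:
  assumes "\<forall>t\<in>P. prime t"
  shows "A * (\<Prod>t\<in>P. divisor_sum (t ^ (2 * x t))) = 2 * cand N P x + 1 \<longleftrightarrow>
    real A * (\<Prod>t\<in>P. power_abundancy t (x t)) = 2 * real N + (\<Prod>t\<in>P. 1 / real (t ^ (2 * x t)))"
proof -
  define Q where "Q = (\<Prod>t\<in>P. real (t ^ (2 * x t)))"
  define S where "S = (\<Prod>t\<in>P. real (divisor_sum (t ^ (2 * x t))))"
  have Q: "Q > 0"
    unfolding Q_def using assms by (intro prod_pos) (simp add: prime_gt_0_nat)
  have "A * (\<Prod>t\<in>P. divisor_sum (t ^ (2 * x t))) = 2 * cand N P x + 1 \<longleftrightarrow>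
      real (A * (\<Prod>t\<in>P. divisor_sum (t ^ (2 * x t)))) = real (2 * cand N P x + 1)"
    by (simp only: of_nat_eq_iff)
  also have "\<dots> \<longleftrightarrow> real A * S = 2 * (real N * Q) + 1"
    by (simp only: Q_def S_def cand_def of_nat_mult of_nat_prod of_nat_add of_nat_numeral of_nat_1)
  also have "\<dots> \<longleftrightarrow> real A * (S / Q) = 2 * real N + 1 / Q"
    using Q by (simp add: field_simps)
  also have "S / Q = (\<Prod>t\<in>P. power_abundancy t (x t))"
    by (simp only: S_def Q_def power_abundancy_def prod_dividef)
  also have "1 / Q = (\<Prod>t\<in>P. 1 / real (t ^ (2 * x t)))"
    by (simp add: Q_def prod_dividef)
  finally show ?thesis .
qed

text \<open>Let \<open>L = A * (\<Prod>t\<in>P. t / (t - 1))\<close>. If \<open>L \<le> 2 * N\<close>, then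
  \<open>left-hand side \<le> L \<le> 2 * N < right-hand side\<close> for all exponents. If \<open>L > 2 * N\<close>, take \<open>M\<close> so large that the
  left-hand side exceeds the right-hand side when all exponents equal \<open>M\<close>; by monotonicity it does
  so whenever all exponents are at least \<open>M\<close>. The set \<open>P\<close> must be nonempty: an empty product is 1 and
  does not tend to 0.\<close>

lemma some_exponent_bounded:
  assumes P: "finite P" "P \<noteq> {}" "\<forall>t\<in>P. prime t"
  obtains M where "\<And>x. x \<in> sols N A P \<Longrightarrow> \<exists>t\<in>P. x t < M"
proof (cases "real A * (\<Prod>t\<in>P. real t / (real t - 1)) \<le> 2 * real N")
  case True
  have "x \<notin> sols N A P" for x
  proof
    assume "x \<in> sols N A P"
    then have "real A * (\<Prod>t\<in>P. power_abundancy t (x t))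
        = 2 * real N + (\<Prod>t\<in>P. 1 / real (t ^ (2 * x t)))"
      using equation_iff_abundancy[OF P(3)] by (simp add: sols_def)
    also have "\<dots> > 2 * real N"
      using P(3) by (auto intro!: prod_pos simp: prime_gt_0_nat)
    finally have "2 * real N < real A * (\<Prod>t\<in>P. power_abundancy t (x t))" .
    also have "\<dots> \<le> real A * (\<Prod>t\<in>P. real t / (real t - 1))"
      using P(3)
      by (intro mult_left_mono prod_mono conjI power_abundancy_nonneg)
         (auto intro: less_imp_le power_abundancy_less)
    finally show False using True by simp
  qed
  then show ?thesis using that by blast
next
  case False
  have "(\<lambda>M. real A * (\<Prod>t\<in>P. power_abundancy t M) - (\<Prod>t\<in>P. 1 / real (t ^ (2 * M))))
      \<longlonglongrightarrow> real A * (\<Prod>t\<in>P. real t / (real t - 1)) - (\<Prod>t\<in>P. 0)"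
    using P(3) by (intro tendsto_intros power_abundancy_tendsto inverse_even_power_tendsto_0) auto
  then have "(\<lambda>M. real A * (\<Prod>t\<in>P. power_abundancy t M) - (\<Prod>t\<in>P. 1 / real (t ^ (2 * M))))
      \<longlonglongrightarrow> real A * (\<Prod>t\<in>P. real t / (real t - 1))"
    using P(1,2) by (simp add: power_0_left)
  then have "\<forall>\<^sub>F M in sequentially. 2 * real N <
      real A * (\<Prod>t\<in>P. power_abundancy t M) - (\<Prod>t\<in>P. 1 / real (t ^ (2 * M)))"
    using False by (intro order_tendstoD(1)) auto
  then obtain M where M: "2 * real N <
      real A * (\<Prod>t\<in>P. power_abundancy t M) - (\<Prod>t\<in>P. 1 / real (t ^ (2 * M)))"
    using eventually_happens'[OF sequentially_bot] by blast
  have "\<exists>t\<in>P. x t < M" if "x \<in> sols N A P" for x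
  proof (rule ccontr)
    assume "\<not> (\<exists>t\<in>P. x t < M)"
    then have ge: "M \<le> x t" if "t \<in> P" for t using that by (simp add: not_less)
    have "2 * real N + (\<Prod>t\<in>P. 1 / real (t ^ (2 * x t)))
        \<le> 2 * real N + (\<Prod>t\<in>P. 1 / real (t ^ (2 * M)))"
    proof (intro add_left_mono prod_mono conjI divide_left_mono)
      fix t assume t: "t \<in> P"
      then have "0 < t" using P(3) by (simp add: prime_gt_0_nat)
      then show "real (t ^ (2 * M)) \<le> real (t ^ (2 * x t))"
        using ge[OF t] by (auto intro!: power_increasing)
      show "0 < real (t ^ (2 * x t)) * real (t ^ (2 * M))" using \<open>0 < t\<close> by simp
    qed simp_all
    also have "\<dots> < real A * (\<Prod>t\<in>P. power_abundancy t M)" using M by simp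
    also have "\<dots> \<le> real A * (\<Prod>t\<in>P. power_abundancy t (x t))"
      using P(3) ge
      by (intro mult_left_mono prod_mono conjI power_abundancy_nonneg power_abundancy_mono) auto
    finally show False
      using that equation_iff_abundancy[OF P(3)] by (simp add: sols_def)
  qed
  then show ?thesis using that by blast
qed

text \<open>The untruncated enumeration of one exponent: the factor of \<open>t\<close> moves from the products over \<open>P\<close>
  into \<open>N\<close> and \<open>A\<close>.\<close>

lemma sols_fix_exponent:
  assumes "finite P" "t \<in> P"
  shows "sols N A P = (\<Union>e\<in>{1..}. (\<lambda>x. x(t := e)) `
    sols (N * t ^ (2 * e)) (A * divisor_sum (t ^ (2 * e))) (P - {t}))"
proof -
  have split: "(\<Prod>s\<in>P. g s (x s)) = g t (x t) * (\<Prod>s\<in>P - {t}. g s (x s))"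
    for g :: "nat \<Rightarrow> nat \<Rightarrow> nat" and x
    using assms by (rule prod.remove)
  have eq: "A * (\<Prod>s\<in>P. divisor_sum (s ^ (2 * x s))) = 2 * cand N P x + 1 \<longleftrightarrow>
      (A * divisor_sum (t ^ (2 * x t))) * (\<Prod>s\<in>P - {t}. divisor_sum (s ^ (2 * x s)))
        = 2 * cand (N * t ^ (2 * x t)) (P - {t}) x + 1" for x
    using split[of "\<lambda>s e. divisor_sum (s ^ (2 * e))" x] split[of "\<lambda>s e. s ^ (2 * e)" x]
    by (simp add: cand_def mult.assoc)
  have upd: "(\<Prod>s\<in>P - {t}. divisor_sum (s ^ (2 * (x(t := e)) s)))
        = (\<Prod>s\<in>P - {t}. divisor_sum (s ^ (2 * x s)))"
      "cand M (P - {t}) (x(t := e)) = cand M (P - {t}) x" for x e M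
    unfolding cand_def by (auto intro!: arg_cong2[where f = "(*)"] prod.cong)
  show ?thesis
  proof (intro equalityI subsetI)
    fix x assume x: "x \<in> sols N A P"
    \<comment> \<open>Functions on \<open>P - {t}\<close> are extensional, so the value at \<open>t\<close> has to be reset.\<close>
    define y where "y = x(t := undefined)"
    have "y \<in> P - {t} \<rightarrow>\<^sub>E {1..}"
      using x by (auto simp: sols_def y_def PiE_iff extensional_def)
    moreover have "(A * divisor_sum (t ^ (2 * x t))) * (\<Prod>s\<in>P - {t}. divisor_sum (s ^ (2 * y s)))
        = 2 * cand (N * t ^ (2 * x t)) (P - {t}) y + 1"
      using x eq[of x] unfolding y_def upd by (simp add: sols_def)
    ultimately have "y \<in> sols (N * t ^ (2 * x t)) (A * divisor_sum (t ^ (2 * x t))) (P - {t})"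
      by (simp add: sols_def)
    moreover have "x = y(t := x t)" by (simp add: y_def)
    moreover have "x t \<in> {1..}" using x assms(2) by (auto simp: sols_def)
    ultimately show "x \<in> (\<Union>e\<in>{1..}. (\<lambda>x. x(t := e)) `
        sols (N * t ^ (2 * e)) (A * divisor_sum (t ^ (2 * e))) (P - {t}))"
      by blast
  next
    fix x assume "x \<in> (\<Union>e\<in>{1..}. (\<lambda>x. x(t := e)) `
        sols (N * t ^ (2 * e)) (A * divisor_sum (t ^ (2 * e))) (P - {t}))"
    then obtain e y where e: "1 \<le> e" and x: "x = y(t := e)"
      and y: "y \<in> sols (N * t ^ (2 * e)) (A * divisor_sum (t ^ (2 * e))) (P - {t})"
      by auto
    have "x \<in> P \<rightarrow>\<^sub>E {1..}"
      using y e assms(2) by (auto simp: sols_def x PiE_iff extensional_def)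
    moreover have "A * (\<Prod>s\<in>P. divisor_sum (s ^ (2 * x s))) = 2 * cand N P x + 1"
      using y unfolding eq unfolding x upd by (simp add: sols_def)
    ultimately show "x \<in> sols N A P" by (simp add: sols_def)
  qed
qed

text \<open>Every solution has some exponent below a common bound \<open>M\<close>. There are finitely many choices for
  that exponent and its value, and each leaves one unknown fewer. The fixed part changes in each
  step, hence \<open>N\<close> and \<open>A\<close> are arbitrary in the induction.\<close>

lemma finite_sols:
  assumes "finite P" "\<forall>t\<in>P. prime t"
  shows "finite (sols N A P)"
  using assms
proof (induction "card P" arbitrary: P N A)
  case 0
  then have "sols N A P \<subseteq> {\<lambda>_. undefined}" by (auto simp: sols_def)
  then show ?case by (rule finite_subset) simp
next
  case (Suc n)
  then have "P \<noteq> {}" by auto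
  then obtain M where M: "\<And>x. x \<in> sols N A P \<Longrightarrow> \<exists>t\<in>P. x t < M"
    using some_exponent_bounded[OF Suc.prems(1) _ Suc.prems(2)] by blast
  let ?S = "\<lambda>t e. (\<lambda>x. x(t := e)) `
    sols (N * t ^ (2 * e)) (A * divisor_sum (t ^ (2 * e))) (P - {t})"
  have "sols N A P \<subseteq> (\<Union>t\<in>P. \<Union>e<M. ?S t e)"
  proof
    fix x assume x: "x \<in> sols N A P"
    then obtain t where t: "t \<in> P" "x t < M" using M by blast
    obtain e where e: "x \<in> ?S t e" using x sols_fix_exponent[OF Suc.prems(1) t(1)] by blast
    then have "x t = e" by auto
    then show "x \<in> (\<Union>t\<in>P. \<Union>e<M. ?S t e)" using e t by blast
  qed
  moreover have "finite (?S t e)" if "t \<in> P" for t e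
    using Suc that by (intro finite_imageI Suc.hyps(1)) auto
  ultimately show ?case using Suc.prems(1) by (auto intro: finite_subset)
qed

text \<open>The truncation value bounds the exponent of \<open>t\<close> over the finite solution set. Larger values of the
  exponent only contribute empty sets to the union.\<close>

lemma truncation_exists:
  assumes "finite P" "\<forall>s\<in>P. prime s" "t \<in> P"
  shows "\<exists>e0. truncated_at N A P t e0"
proof -
  have "finite ((\<lambda>x. x t) ` sols N A P)"
    by (intro finite_imageI finite_sols assms(1,2))
  then obtain e0 where e0: "\<And>x. x \<in> sols N A P \<Longrightarrow> x t \<le> e0"
    unfolding finite_nat_set_iff_bounded_le by blast
  let ?S = "\<lambda>e. (\<lambda>x. x(t := e)) `
    sols (N * t ^ (2 * e)) (A * divisor_sum (t ^ (2 * e))) (P - {t})"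
  have all: "sols N A P = (\<Union>e\<in>{1..}. ?S e)" by (rule sols_fix_exponent[OF assms(1,3)])
  have "e \<le> e0" if "x \<in> ?S e" "1 \<le> e" for x e
  proof -
    have "x \<in> sols N A P" unfolding all using that by blast
    moreover have "x t = e" using that(1) by auto
    ultimately show ?thesis using e0 by blast
  qed
  then have "(\<Union>e\<in>{1..}. ?S e) = (\<Union>e\<in>{1..e0}. ?S e)" by fastforce
  then have "truncated_at N A P t e0" unfolding truncated_at_def using e0 all by simp
  then show ?thesis ..
qed

text \<open>Each fixed exponent lowers the number of unknowns by one, and a truncation value exists for every
  fixed part.\<close>

lemma recursion_terminates:
  assumes "finite P" "\<forall>s\<in>P. prime s" "2 \<le> card P"
  shows "fix_one_recurse N A P"
  using assms
proof (induction "card P" arbitrary: P N A)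
  case 0
  then show ?case by simp
next
  case (Suc n)
  show ?case
  proof (cases "card P = 2")
    case True
    then show ?thesis by (auto simp: card_2_iff intro: fix_one_recurse.two)
  next
    case False
    have "fix_one_recurse N' A' (P - {t})" if "t \<in> P" for t N' A'
      using Suc False that by (intro Suc.hyps(1)) auto
    then show ?thesis
      using Suc.prems False truncation_exists[OF Suc.prems(1,2)]
      by (intro fix_one_recurse.fix_one) auto
  qed
qed

lemma sols_two_primes:
  assumes "t1 \<noteq> t2"
  shows "sols N A {t1, t2} = {x \<in> {t1, t2} \<rightarrow>\<^sub>E UNIV. (x t1, x t2) \<in> sols2 N A t1 t2}"
proof -
  have "{t1, t2} \<rightarrow>\<^sub>E {1..} = {x \<in> {t1, t2} \<rightarrow>\<^sub>E UNIV. 1 \<le> x t1 \<and> 1 \<le> x t2}"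
    by (auto simp: PiE_iff extensional_def)
  then show ?thesis
    unfolding sols_def sols2_def cand_def using assms by (auto simp: mult.assoc)
qed

lemma sols_iff_quasiperfect:
  assumes "finite P" "\<forall>s\<in>P. prime s" "\<forall>s\<in>P. \<not> s dvd N" "x \<in> P \<rightarrow>\<^sub>E {1..}"
  shows "x \<in> sols N (divisor_sum N) P \<longleftrightarrow> divisor_sum (cand N P x) = 2 * cand N P x + 1"
  using assms(4) divisor_sum_cand[OF assms(1-3), of x] by (simp add: sols_def)

text \<open>From \<open>\<sigma>(m) \<ge> 2 * m + 2\<close> one gets \<open>\<sigma>(k * m) \<ge> 2 * k * m + 2 * k\<close>, which is above \<open>2 * k * m + 1\<close> for
  \<open>k \<ge> 1\<close>.\<close>

lemma multiple_not_quasiperfect: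
  assumes "divisor_sum m > 2 * m + 1" "m dvd n" "n > 0"
  shows "divisor_sum n \<noteq> 2 * n + 1"
proof -
  obtain k where n: "n = k * m" using assms(2) by (metis dvd_def mult.commute)
  then have "m > 0" "k > 0" using assms(3) by auto
  then have "k * (2 * m + 2) \<le> divisor_sum n"
    unfolding n using assms(1)
    by (intro order_trans[OF mult_le_mono2 divisor_sum_multiple_ge]) auto
  then show ?thesis using n \<open>k > 0\<close> by (simp add: algebra_simps)
qed

lemma cand_dvd_cand:
  assumes "\<And>t. t \<in> P \<Longrightarrow> y t \<le> x t"
  shows "cand N P y dvd cand N P x"
  unfolding cand_def using assms
  by (intro mult_dvd_mono prod_dvd_prod le_imp_power_dvd) auto

text \<open>The lowest candidate divides every candidate with the exponent of \<open>s\<close> at least \<open>e\<close>.\<close>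

lemma abundant_lower_candidate_excludes:
  assumes "N > 0" "finite P" "\<forall>s\<in>P. prime s" "\<forall>s\<in>P. \<not> s dvd N"
    and "divisor_sum (cand N P ((\<lambda>_. 1)(s := e))) > 2 * cand N P ((\<lambda>_. 1)(s := e)) + 1"
    and "x \<in> P \<rightarrow>\<^sub>E {1..}" "e \<le> x s"
  shows "x \<notin> sols N (divisor_sum N) P"
proof -
  have "cand N P ((\<lambda>_. 1)(s := e)) dvd cand N P x"
    using assms(6,7) by (intro cand_dvd_cand) (auto simp: PiE_iff)
  moreover have "cand N P x > 0"
    using assms(1-3) by (auto simp: cand_def prime_gt_0_nat intro!: prod_pos)
  ultimately have "divisor_sum (cand N P x) \<noteq> 2 * cand N P x + 1"
    by (rule multiple_not_quasiperfect[OF assms(5)])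
  then show ?thesis using sols_iff_quasiperfect[OF assms(2-4,6)] by simp
qed


theorem lemma3:
  fixes N A t t1 t2 :: nat
  assumes "N > 0" and "A > 0" and "prime t" and "prime t1" and "prime t2"
  shows
    "\<comment> \<open>(i)\<close>
     (let C = lin_coeff N A t; R = int A + int t - 1 in
       (\<forall>e\<ge>1. A * divisor_sum (t ^ (2 * e)) = 2 * N * t ^ (2 * e) + 1
          \<longleftrightarrow> int (t ^ (2 * e)) * C = R) \<and>
       (\<forall>e\<ge>1. A * divisor_sum (t ^ (2 * e)) = 2 * N * t ^ (2 * e) + 1
          \<longleftrightarrow> C \<noteq> 0 \<and> real (t ^ (2 * e)) = of_int R / of_int C) \<and>
       (\<not> C dvd R \<longrightarrow> (\<nexists>V::int. V * C = R) \<and> sols1 N A t = {}) \<and>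
       (C dvd R \<longrightarrow>
          (\<exists>!V::int. V * C = R) \<and> (R div C) * C = R \<and>
          sols1 N A t = {e. 1 \<le> e \<and> int (t ^ (2 * e)) = R div C} \<and>
          (\<exists>\<^sub>\<le>\<^sub>1 e. e \<in> sols1 N A t)))
     \<and> \<comment> \<open>(ii)\<close>
     (let d2 = d2_coeff N A t1 t2; p = V2_pole N A t1 t2; f = V2_fun N A t1 t2 in
       (\<forall>e1\<ge>1. \<forall>e2\<ge>1.
          A * divisor_sum (t1 ^ (2 * e1)) * divisor_sum (t2 ^ (2 * e2))
            = 2 * N * t1 ^ (2 * e1) * t2 ^ (2 * e2) + 1
          \<longleftrightarrow> V2_denom N A t1 t2 (real (t1 ^ (2 * e1))) \<noteq> 0 \<and>
              real (t2 ^ (2 * e2)) = f (real (t1 ^ (2 * e1)))) \<and>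
       (sols2 N A t1 t2 \<noteq> {} \<longrightarrow> d2 > 0) \<and>
       (d2 > 0 \<longrightarrow> V2_det N A t1 t2 \<noteq> 0) \<and>
       (d2 \<noteq> 0 \<longrightarrow>
          (\<forall>v. V2_denom N A t1 t2 v = 0 \<longleftrightarrow> v = p) \<and>
          (mono_on {p<..} f \<or> antimono_on {p<..} f) \<and>
          (V2_det N A t1 t2 \<noteq> 0 \<longrightarrow>
             (\<forall>v. filterlim f at_infinity (at v) \<longleftrightarrow> v = p) \<and>
             (strict_mono_on {p<..} f \<or> strict_antimono_on {p<..} f)) \<and>
          1 \<le> first_exp N A t1 t2 \<and> p < real (t1 ^ (2 * first_exp N A t1 t2)) \<and>
          (f \<longlongrightarrow> V2_limit N A t1 t2) at_top \<and>
          V2_first N A t1 t2 \<in> \<rat> \<and> V2_limit N A t1 t2 \<in> \<rat> \<and>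
          (\<forall>e1\<ge>1. p < real (t1 ^ (2 * e1)) \<longrightarrow> f (real (t1 ^ (2 * e1))) \<in> envelope N A t1 t2) \<and>
          finite (candidates N A t1 t2) \<and>
          (\<forall>(e1, e2) \<in> sols2 N A t1 t2. p < real (t1 ^ (2 * e1))) \<and>
          sols2 N A t1 t2 = (\<Union>e2 \<in> candidates N A t1 t2.
             sols1 (N * t2 ^ (2 * e2)) (A * divisor_sum (t2 ^ (2 * e2))) t1 \<times> {e2})) \<and>
       finite (sols2 N A t1 t2))
     \<and> \<comment> \<open>(iii)\<close>
     (t1 \<noteq> t2 \<longrightarrow>
       sols N A {t1, t2} = {x \<in> {t1, t2} \<rightarrow>\<^sub>E UNIV. (x t1, x t2) \<in> sols2 N A t1 t2})
     \<and>
     (\<forall>P. finite P \<and> (\<forall>s\<in>P. prime s) \<and> 3 \<le> card P \<longrightarrow>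
       (\<forall>s\<in>P. \<exists>e0. truncated_at N A P s e0) \<and>
       fix_one_recurse N A P \<and>
       finite (sols N A P) \<and>
       (divisor_sum N = A \<and> (\<forall>s\<in>P. \<not> s dvd N) \<longrightarrow>
          (\<forall>x \<in> P \<rightarrow>\<^sub>E {1..}.
             x \<in> sols N A P \<longleftrightarrow> divisor_sum (cand N P x) = 2 * cand N P x + 1) \<and>
          (\<forall>s\<in>P. \<forall>e\<ge>1.
             (let N_lo = cand N P ((\<lambda>_. 1)(s := e)) in
               divisor_sum N_lo > 2 * N_lo + 1 \<longrightarrow>
               (\<forall>x \<in> P \<rightarrow>\<^sub>E {1..}. e \<le> x s \<longrightarrow> x \<notin> sols N A P)))))"
proof (intro conjI, goal_cases)
  case 1
  let ?C = "lin_coeff N A t" and ?R = "int A + int t - 1"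
  note closed = one_exponent_closed_form[OF assms(2,3), where N = N]
  have linear: "\<forall>e\<ge>1. A * divisor_sum (t ^ (2 * e)) = 2 * N * t ^ (2 * e) + 1
      \<longleftrightarrow> int (t ^ (2 * e)) * ?C = ?R"
    using one_exponent_iff_linear[OF assms(3)] by blast
  have quotient: "\<forall>e\<ge>1. A * divisor_sum (t ^ (2 * e)) = 2 * N * t ^ (2 * e) + 1
      \<longleftrightarrow> ?C \<noteq> 0 \<and> real (t ^ (2 * e)) = of_int ?R / of_int ?C"
    using linear unfolding closed(1)[symmetric] by blast
  have unique: "\<exists>\<^sub>\<le>\<^sub>1 e. e \<in> sols1 N A t"
    using one_exponent_unique[OF assms(2,3)] by (simp add: Uniq_def)
  show ?case
    unfolding Let_def using linear quotient unique closed(2,3) by blast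
next
  case 2
  show ?case
    unfolding Let_def
    \<comment> \<open>Used backwards, positivity of \<open>d2\<close> and the nonvanishing determinant would also replace
      goals that are hypotheses of other conjuncts, so they are left to the second step.\<close>
    by (intro conjI impI allI two_exponents_iff_V2_fun V2_pole_iff V2_fun_monotone
        V2_fun_pole V2_fun_strictly_monotone first_exp V2_fun_tendsto
        V2_rational V2_fun_in_envelope finite_candidates sols2_right_of_pole sols2_eq_union_sols1
        finite_sols2 assms)
      (use d2_coeff_pos_if_solvable V2_det_nonzero assms in blast)+
next
  case 3
  show ?case by (intro impI sols_two_primes)
next
  case 4
  show ?case
  proof (intro allI impI, elim conjE, intro conjI impI ballI)
    fix P :: "nat set"
    assume P: "finite P" "\<forall>s\<in>P. prime s" "3 \<le> card P"
    show "\<exists>e0. truncated_at N A P s e0" if "s \<in> P" for s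
      using P that by (intro truncation_exists)
    show "fix_one_recurse N A P" using P by (intro recursion_terminates) auto
    show "finite (sols N A P)" using P by (intro finite_sols)
    assume "divisor_sum N = A \<and> (\<forall>s\<in>P. \<not> s dvd N)"
    then have A: "A = divisor_sum N" and N: "\<forall>s\<in>P. \<not> s dvd N" by auto
    show "x \<in> sols N A P \<longleftrightarrow> divisor_sum (cand N P x) = 2 * cand N P x + 1"
      if "x \<in> P \<rightarrow>\<^sub>E {1..}" for x
      unfolding A using P N that by (intro sols_iff_quasiperfect)
    show "\<forall>e\<ge>1. let N_lo = cand N P ((\<lambda>_. 1)(s := e)) in
        divisor_sum N_lo > 2 * N_lo + 1 \<longrightarrow>
        (\<forall>x \<in> P \<rightarrow>\<^sub>E {1..}. e \<le> x s \<longrightarrow> x \<notin> sols N A P)" for s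
      unfolding A Let_def
      using abundant_lower_candidate_excludes[OF assms(1) P(1,2) N] by blast
  qed
qed

end
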